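(* The space $\ell_1$ equipped with the weak topology $\sigma(\ell_1, \ell_\infty)$ is sequentially complete, but is not boundedly complete over any free ultrafilter $\mathcal U$ on $\mathbb N$.
   Context: $\sigma(\ell_1,\ell_\infty)$ is the weak topology on $\ell_1$ generated by the functionals $y \mapsto x(y) = \sum_{n \in \mathbb N} x_n y_n$, $x = (x_n) \in \ell_\infty$, $y = (y_n) \in \ell_1$. Scalars are $\mathbb K \in \{\mathbb R, \mathbb C\}$. A filter on $\mathbb N$ is free if it contains the Fréchet filter of all cofinite subsets of $\mathbb N$; an ultrafilter is a maximal (proper) filter. Let $X$ be a Hausdorff topological vector space. For a filter $\mathcal F$ on $\mathbb N$, a sequence $(x_n) \subset X$ is a Cauchy sequence over $\mathcal F$ if for every neighborhood $U$ of $0$ there is $B \in \mathcal F$ with $x_n - x_m \in U$ for all $n,m \in B$; it has limit $y \in X$ over $\mathcal F$ if for every neighborhood $V$ of $y$ there is $B \in \mathcal F$ with $x_n \in V$ for all $n \in B$. $X$ is boundedly complete over $\mathcal F$ if every bounded (in the topological vector space sense) sequence in $X$ that is Cauchy over $\mathcal F$ has a limit over $\mathcal F$ in $X$. $X$ is sequentially complete if every ordinary Cauchy sequence in $X$ (i.e. Cauchy over the Fréchet filter) converges in $X$. *)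

theory Defs
  imports "HOL-Analysis.Analysis" "HOL-Library.Function_Algebras"
begin

section \<open>Filters on the index set\<close>

text \<open>
  In the library order on filters, \<open>G \<le> F\<close> means that \<open>G\<close> contains every set of \<open>F\<close>;
  the improper filter is \<open>bot\<close>. Hence maximal proper filters are minimal elements
  above \<open>bot\<close>, and containing the Frechet filter means lying below \<open>cofinite\<close>.
\<close>

definition free_filter :: "'i filter \<Rightarrow> bool" where
  "free_filter F \<longleftrightarrow> F \<le> cofinite"

definition ultrafilter :: "'i filter \<Rightarrow> bool" where
  "ultrafilter F \<longleftrightarrow> F \<noteq> bot \<and> (\<forall>G. G \<noteq> bot \<and> G \<le> F \<longrightarrow> G = F)"


section \<open>Topological vector spaces and completeness over a filter\<close>

text \<open>
  A topological vector space is a topology \<open>T\<close> whose carrier \<open>topspace T\<close> is a linear subspace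
  of an ambient vector space with scalar multiplication \<open>scl\<close>. The notions after
  \<open>hausdorff_tvs\<close> are meant for such spaces, and neighbourhoods are taken open.
\<close>

definition hausdorff_tvs ::
    "('k::real_normed_field \<Rightarrow> 'v::ab_group_add \<Rightarrow> 'v) \<Rightarrow> 'v topology \<Rightarrow> bool" where
  "hausdorff_tvs scl T \<longleftrightarrow>
     vector_space scl \<and> module.subspace scl (topspace T) \<and> Hausdorff_space T \<and>
     continuous_map (prod_topology T T) T (\<lambda>(x, y). x + y) \<and>
     continuous_map (prod_topology euclidean T) T (\<lambda>(c, y). scl c y)"

definition cauchy_over ::
    "'v::ab_group_add topology \<Rightarrow> nat filter \<Rightarrow> (nat \<Rightarrow> 'v) \<Rightarrow> bool" where
  "cauchy_over T F x \<longleftrightarrow>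
     (\<forall>U. openin T U \<and> 0 \<in> U \<longrightarrow>
        (\<exists>B. eventually (\<lambda>n. n \<in> B) F \<and> (\<forall>n\<in>B. \<forall>m\<in>B. x n - x m \<in> U)))"

definition tvs_bounded ::
    "('k::real_normed_field \<Rightarrow> 'v::ab_group_add \<Rightarrow> 'v) \<Rightarrow> 'v topology \<Rightarrow> 'v set \<Rightarrow> bool" where
  "tvs_bounded scl T A \<longleftrightarrow>
     A \<subseteq> topspace T \<and>
     (\<forall>U. openin T U \<and> 0 \<in> U \<longrightarrow>
        (\<exists>r>0. \<forall>c. norm c \<ge> r \<longrightarrow> A \<subseteq> scl c ` U))"

text \<open>The limit of \<open>x\<close> over \<open>F\<close> is the library notion \<open>limitin T x y F\<close>.\<close>

definition boundedly_complete_over ::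
    "('k::real_normed_field \<Rightarrow> 'v::ab_group_add \<Rightarrow> 'v) \<Rightarrow> 'v topology \<Rightarrow> nat filter \<Rightarrow> bool" where
  "boundedly_complete_over scl T F \<longleftrightarrow>
     (\<forall>x. range x \<subseteq> topspace T \<and> tvs_bounded scl T (range x) \<and> cauchy_over T F x
        \<longrightarrow> (\<exists>y. limitin T x y F))"

text \<open>On \<open>nat\<close>, \<open>sequentially\<close> is the Frechet filter (\<open>cofinite_eq_sequentially\<close>).\<close>

definition sequentially_complete_tvs :: "'v::ab_group_add topology \<Rightarrow> bool" where
  "sequentially_complete_tvs T \<longleftrightarrow>
     (\<forall>x. range x \<subseteq> topspace T \<and> cauchy_over T sequentially x
        \<longrightarrow> (\<exists>y. limitin T x y sequentially))"


section \<open>The weak topology of the space of absolutely summable sequences\<close>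

definition seq_scale :: "'k::real_normed_field \<Rightarrow> (nat \<Rightarrow> 'k) \<Rightarrow> (nat \<Rightarrow> 'k)" where
  "seq_scale c y = (\<lambda>n. c * y n)"

definition l1_set :: "(nat \<Rightarrow> 'k::{real_normed_field,banach}) set" where
  "l1_set = {y. summable (\<lambda>n. norm (y n))}"

definition linf_set :: "(nat \<Rightarrow> 'k::{real_normed_field,banach}) set" where
  "linf_set = {x. bounded (range x)}"

definition pairing ::
    "(nat \<Rightarrow> 'k::{real_normed_field,banach}) \<Rightarrow> (nat \<Rightarrow> 'k) \<Rightarrow> 'k" where
  "pairing x y = (\<Sum>n. x n * y n)"

definition weak_l1 :: "(nat \<Rightarrow> 'k::{real_normed_field,banach}) topology" where
  "weak_l1 = topology_generated_by
     {{y \<in> l1_set. pairing x y \<in> U} | x U. x \<in> linf_set \<and> open U}"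


subsection \<open>It is a Hausdorff topological vector space\<close>

lemma topspace_weak_l1: "topspace weak_l1 = l1_set"
proof -
  have "(\<lambda>n. 0) \<in> (linf_set :: (nat \<Rightarrow> 'k::{real_normed_field,banach}) set)"
    by (simp add: linf_set_def)
  then show ?thesis
    unfolding weak_l1_def topology_generated_by_topspace by blast
qed

lemma summable_pairing:
  assumes "x \<in> linf_set" "y \<in> l1_set"
  shows "summable (\<lambda>n. x n * y n)"
proof -
  obtain M where M: "\<And>n. norm (x n) \<le> M"
    using assms(1) unfolding linf_set_def bounded_iff by auto
  have "summable (\<lambda>n. M * norm (y n))"
    using assms(2) by (simp add: l1_set_def summable_mult)
  moreover have "norm (x n * y n) \<le> M * norm (y n)" for n
    using M[of n] by (simp add: norm_mult mult_right_mono)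
  ultimately show ?thesis
    by (meson summable_comparison_test')
qed

lemma l1_set_add: "x \<in> l1_set \<Longrightarrow> y \<in> l1_set \<Longrightarrow> x + y \<in> l1_set"
  unfolding l1_set_def mem_Collect_eq
  by (rule summable_comparison_test'[where N = 0 and g = "\<lambda>n. norm (x n) + norm (y n)"])
     (auto intro: summable_add norm_triangle_ineq)

lemma l1_set_scale: "y \<in> l1_set \<Longrightarrow> seq_scale c y \<in> l1_set"
  by (simp add: l1_set_def seq_scale_def norm_mult summable_mult)

lemma pairing_add:
  assumes "x \<in> linf_set" "y \<in> l1_set" "z \<in> l1_set"
  shows "pairing x (y + z) = pairing x y + pairing x z"
  using suminf_add[OF summable_pairing[OF assms(1,2)] summable_pairing[OF assms(1,3)]]
  by (simp add: pairing_def distrib_left)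

lemma pairing_scale:
  assumes "x \<in> linf_set" "y \<in> l1_set"
  shows "pairing x (seq_scale c y) = c * pairing x y"
  using suminf_mult[OF summable_pairing[OF assms], of c]
  by (simp add: pairing_def seq_scale_def algebra_simps)

lemma continuous_map_pairing:
  assumes "x \<in> linf_set"
  shows "continuous_map weak_l1 euclidean (pairing x)"
proof -
  have "openin weak_l1 {y \<in> topspace weak_l1. pairing x y \<in> U}" if "open U" for U
    unfolding topspace_weak_l1 unfolding weak_l1_def
    by (rule topology_generated_by_Basis) (use assms that in blast)
  then show ?thesis
    by (auto simp: continuous_map)
qed

lemma continuous_map_into_weak_l1:
  fixes f :: "'a \<Rightarrow> nat \<Rightarrow> 'k::{real_normed_field,banach}"
  assumes "f ` topspace X \<subseteq> l1_set"
    and "\<And>x. x \<in> linf_set \<Longrightarrow> continuous_map X euclidean (\<lambda>a. pairing x (f a))"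
  shows "continuous_map X weak_l1 f"
  unfolding weak_l1_def
proof (rule continuous_on_generated_topo)
  fix W :: "(nat \<Rightarrow> 'k) set" assume "W \<in> {{y \<in> l1_set. pairing x y \<in> U} | x U. x \<in> linf_set \<and> open U}"
  then obtain x :: "nat \<Rightarrow> 'k" and U where x: "x \<in> linf_set" "open U" and W: "W = {y \<in> l1_set. pairing x y \<in> U}"
    by blast
  have "f -` W \<inter> topspace X = {a \<in> topspace X. pairing x (f a) \<in> U}"
    using assms(1) W by auto
  then show "openin X (f -` W \<inter> topspace X)"
    using assms(2)[OF x(1)] x(2) by (simp add: continuous_map)
next
  have eq: "\<Union> {{y \<in> l1_set. pairing x y \<in> U} | x U. x \<in> linf_set \<and> open U}
      = (l1_set :: (nat \<Rightarrow> 'k) set)"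
    using topspace_weak_l1 unfolding weak_l1_def topology_generated_by_topspace .
  show "f ` (topspace X) \<subseteq> \<Union> {{y \<in> l1_set. pairing x y \<in> U} | x U. x \<in> linf_set \<and> open U}"
    unfolding eq using assms(1) by auto
qed

lemma Hausdorff_weak_l1: "Hausdorff_space (weak_l1 :: (nat \<Rightarrow> 'k::{real_normed_field,banach}) topology)"
  unfolding Hausdorff_space_def topspace_weak_l1
proof (intro allI impI, elim conjE)
  fix y z :: "nat \<Rightarrow> 'k" assume yz: "y \<in> l1_set" "z \<in> l1_set" "y \<noteq> z"
  then obtain k where k: "y k \<noteq> z k" by blast
  define e :: "nat \<Rightarrow> 'k" where "e = (\<lambda>n. if n = k then 1 else 0)"
  have "range e \<subseteq> {0, 1}" by (auto simp: e_def)
  then have e: "e \<in> linf_set"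
    unfolding linf_set_def mem_Collect_eq by (rule bounded_subset[rotated]) simp
  have p: "pairing e w = w k" for w
  proof -
    have "(\<lambda>n. e n * w n) = (\<lambda>n. if n = k then w n else 0)" by (auto simp: e_def)
    then show ?thesis
      unfolding pairing_def using sums_single[of k w] by (simp add: sums_iff)
  qed
  obtain U V where UV: "open U" "open V" "y k \<in> U" "z k \<in> V" "U \<inter> V = {}"
    using hausdorff[OF k] by blast
  have "openin weak_l1 {w \<in> l1_set. pairing e w \<in> U}" "openin weak_l1 {w \<in> l1_set. pairing e w \<in> V}"
    using continuous_map_pairing[OF e] UV(1,2) by (auto simp: continuous_map topspace_weak_l1)
  then show "\<exists>U V. openin weak_l1 U \<and> openin weak_l1 V \<and> y \<in> U \<and> z \<in> V \<and> disjnt U V"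
    using yz UV p
    by (intro exI[of _ "{w \<in> l1_set. pairing e w \<in> U}"] exI[of _ "{w \<in> l1_set. pairing e w \<in> V}"])
       (auto simp: disjnt_def)
qed

lemma vector_space_seq_scale: "vector_space seq_scale"
  by unfold_locales (auto simp: seq_scale_def fun_eq_iff algebra_simps)

lemma hausdorff_tvs_weak_l1:
  "hausdorff_tvs seq_scale (weak_l1 :: (nat \<Rightarrow> 'k::{real_normed_field,banach}) topology)"
  unfolding hausdorff_tvs_def
proof (intro conjI)
  let ?T = "weak_l1 :: (nat \<Rightarrow> 'k) topology"
  show vs: "vector_space (seq_scale :: 'k \<Rightarrow> _)" by (rule vector_space_seq_scale)
  interpret vector_space "seq_scale :: 'k \<Rightarrow> _" by (rule vs)
  show "subspace (topspace ?T)"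
    unfolding topspace_weak_l1
    by (rule subspaceI) (auto simp: l1_set_add l1_set_scale, simp add: l1_set_def)
  show "Hausdorff_space ?T" by (rule Hausdorff_weak_l1)
  show "continuous_map (prod_topology ?T ?T) ?T (\<lambda>(x, y). x + y)"
  proof (rule continuous_map_into_weak_l1)
    show "(\<lambda>(x, y). x + y) ` topspace (prod_topology ?T ?T) \<subseteq> l1_set"
      by (auto simp: topspace_weak_l1 l1_set_add)
  next
    fix x :: "nat \<Rightarrow> 'k" assume x: "x \<in> linf_set"
    have "continuous_map (prod_topology ?T ?T) euclidean (\<lambda>a. pairing x (fst a) + pairing x (snd a))"
      by (intro continuous_map_add
            continuous_map_compose[OF continuous_map_fst continuous_map_pairing[OF x], unfolded o_def]
            continuous_map_compose[OF continuous_map_snd continuous_map_pairing[OF x], unfolded o_def])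
    then show "continuous_map (prod_topology ?T ?T) euclidean (\<lambda>a. pairing x (case a of (u, v) \<Rightarrow> u + v))"
      by (rule continuous_map_eq) (auto simp: topspace_weak_l1 pairing_add x)
  qed
  show "continuous_map (prod_topology euclidean ?T) ?T (\<lambda>(c, y). seq_scale c y)"
  proof (rule continuous_map_into_weak_l1)
    show "(\<lambda>(c, y). seq_scale c y) ` topspace (prod_topology euclidean ?T) \<subseteq> l1_set"
      by (auto simp: topspace_weak_l1 l1_set_scale)
  next
    fix x :: "nat \<Rightarrow> 'k" assume x: "x \<in> linf_set"
    have mult: "continuous_map (prod_topology euclidean euclidean) euclidean (\<lambda>p. fst p * snd p :: 'k)"
      by (simp add: euclidean_product_topology continuous_map_iff_continuous2 continuous_on_mult
            continuous_on_fst continuous_on_snd)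
    have "continuous_map (prod_topology euclidean ?T) (prod_topology euclidean euclidean)
            (\<lambda>a. (fst a, pairing x (snd a)))"
      by (intro continuous_map_pairedI continuous_map_fst
            continuous_map_compose[OF continuous_map_snd continuous_map_pairing[OF x], unfolded o_def])
    from continuous_map_compose[OF this mult]
    have "continuous_map (prod_topology euclidean ?T) euclidean (\<lambda>a. fst a * pairing x (snd a))"
      by (simp add: o_def)
    then show "continuous_map (prod_topology euclidean ?T) euclidean
        (\<lambda>a. pairing x (case a of (c, y) \<Rightarrow> seq_scale c y))"
      by (rule continuous_map_eq) (auto simp: topspace_weak_l1 pairing_scale x)
  qed
qed

end

theory Submission
  imports Defs
begin

text \<open>
  Sequential completeness comes from Schur's theorem: a weakly null sequence in \<open>\<ell>\<^sub>1\<close> is norm null.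
  Applied to differences \<open>x\<^sub>p - x\<^sub>q\<close> with \<open>p\<close> and \<open>q\<close> tending to infinity, it turns a weakly Cauchy
  sequence into a norm Cauchy sequence, whose coordinatewise limit lies in \<open>\<ell>\<^sub>1\<close> and is a norm limit,
  hence a weak limit. Schur's theorem itself is a gliding hump argument (\<open>norm_block_exists\<close>,
  \<open>l1_schur\<close>): if the norms stay away from \<open>0\<close>, there are members of the sequence most of
  whose norm is concentrated on consecutive blocks of indices, and one bounded functional that
  matches the signs on every block is large on infinitely many of them.

  Over a free ultrafilter the unit vectors \<open>e\<^sub>n\<close> are a counterexample. The value of \<open>x\<close> at \<open>e\<^sub>n\<close> is
  \<open>x\<^sub>n\<close>, and a bounded scalar sequence converges along every ultrafilter because closed balls of
  scalars are compact; so \<open>(e\<^sub>n)\<close> is bounded and Cauchy. A limit would have all coordinates \<open>0\<close>, as each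
  coordinate of \<open>e\<^sub>n\<close> vanishes for all but one \<open>n\<close>, whereas summing the coordinates gives \<open>1\<close>
  along the whole sequence.

  Everything about the weak topology goes through \<open>limitin_weak_l1_iff\<close>. Both the Cauchy property and
  boundedness are instances of convergence to \<open>0\<close>: of the differences along the square of the
  filter, and of \<open>y / c\<close> as \<open>c\<close> tends to infinity, uniformly in \<open>y\<close>.
\<close>

section \<open>Convergence in the weak topology\<close>

lemma zero_in_l1_set: "0 \<in> l1_set"
  by (simp add: l1_set_def)

lemma l1_set_diff: "x \<in> l1_set \<Longrightarrow> y \<in> l1_set \<Longrightarrow> x - y \<in> l1_set"
  unfolding l1_set_def mem_Collect_eq
  by (rule summable_comparison_test'[where N = 0 and g = "\<lambda>n. norm (x n) + norm (y n)"])
     (auto intro: summable_add norm_triangle_ineq4)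

lemma pairing_diff:
  assumes "x \<in> linf_set" "y \<in> l1_set" "z \<in> l1_set"
  shows "pairing x (y - z) = pairing x y - pairing x z"
  using suminf_diff[OF summable_pairing[OF assms(1,2)] summable_pairing[OF assms(1,3)]]
  by (simp add: pairing_def right_diff_distrib)

lemma pairing_zero: "pairing x 0 = 0"
  by (simp add: pairing_def)

definition unit_vec :: "nat \<Rightarrow> nat \<Rightarrow> 'k::{real_normed_field,banach}" where
  "unit_vec k = (\<lambda>n. if n = k then 1 else 0)"

lemma unit_vec_in_l1_set: "unit_vec k \<in> l1_set"
proof -
  have "(\<lambda>n. norm (unit_vec k n :: 'a)) = (\<lambda>n. if n = k then 1 else 0)"
    by (auto simp: unit_vec_def)
  then show ?thesis
    using sums_single[of k "\<lambda>_. 1::real"] by (simp add: l1_set_def sums_iff)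
qed

lemma linf_setI: "(\<And>n. norm (x n) \<le> M) \<Longrightarrow> x \<in> linf_set"
  by (auto simp: linf_set_def bounded_iff)

lemma unit_vec_in_linf_set: "unit_vec k \<in> linf_set"
  by (rule linf_setI[of _ 1]) (simp add: unit_vec_def)

lemma pairing_unit_vec_left: "pairing (unit_vec k) y = y k"
proof -
  have "(\<lambda>n. unit_vec k n * y n) = (\<lambda>n. if n = k then y n else 0)"
    by (auto simp: unit_vec_def)
  then show ?thesis
    unfolding pairing_def using sums_single[of k y] by (simp add: sums_iff)
qed

lemma pairing_unit_vec_right: "pairing x (unit_vec k) = x k"
  using pairing_unit_vec_left[of k x] by (simp add: pairing_def mult.commute)

text \<open>
  The sets through which the topology is generated are a subbase only; finite intersections cause
  no difficulty because finitely many eventual statements hold simultaneously.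
\<close>

lemma limitin_weak_l1_iff:
  fixes f :: "'i \<Rightarrow> nat \<Rightarrow> 'k::{real_normed_field,banach}"
  assumes "\<And>i. f i \<in> l1_set"
  shows "limitin weak_l1 f y F \<longleftrightarrow>
    y \<in> l1_set \<and> (\<forall>a\<in>linf_set. ((\<lambda>i. pairing a (f i)) \<longlongrightarrow> pairing a y) F)"
proof (intro iffI conjI ballI)
  assume lim: "limitin weak_l1 f y F"
  then show "y \<in> l1_set"
    by (simp add: limitin_def topspace_weak_l1)
  fix a :: "nat \<Rightarrow> 'k" assume "a \<in> linf_set"
  from continuous_map_limit[OF continuous_map_pairing[OF this] lim]
  show "((\<lambda>i. pairing a (f i)) \<longlongrightarrow> pairing a y) F"
    by (simp add: o_def)
next
  assume R: "y \<in> l1_set \<and> (\<forall>a\<in>linf_set. ((\<lambda>i. pairing a (f i)) \<longlongrightarrow> pairing a y) F)"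
  let ?S = "{{y \<in> l1_set. pairing x y \<in> U} | (x :: nat \<Rightarrow> 'k) U. x \<in> linf_set \<and> open U}"
  have "y \<in> W \<longrightarrow> (\<forall>\<^sub>F i in F. f i \<in> W)" if "generate_topology_on ?S W" for W
    using that
  proof induction
    case (Int a b)
    then show ?case by (auto intro: eventually_conj)
  next
    case (UN K)
    then show ?case by (fastforce elim: eventually_mono)
  next
    case (Basis s)
    then obtain x U where "x \<in> linf_set" "open U" and s: "s = {y \<in> l1_set. pairing x y \<in> U}"
      by blast
    then show ?case
      using R assms topological_tendstoD[of "\<lambda>i. pairing x (f i)" "pairing x y" F U] by auto
  qed simp
  then have "\<forall>W. openin weak_l1 W \<and> y \<in> W \<longrightarrow> (\<forall>\<^sub>F i in F. f i \<in> W)"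
    unfolding weak_l1_def openin_topology_generated_by_iff by blast
  then show "limitin weak_l1 f y F"
    using R by (simp add: limitin_def topspace_weak_l1)
qed

lemma cauchy_over_iff_limitin:
  assumes "0 \<in> topspace T"
  shows "cauchy_over T F x \<longleftrightarrow> limitin T (\<lambda>(n, m). x n - x m) 0 (F \<times>\<^sub>F F)"
proof -
  have "(\<exists>B. eventually (\<lambda>n. n \<in> B) F \<and> (\<forall>n\<in>B. \<forall>m\<in>B. x n - x m \<in> U)) \<longleftrightarrow>
      (\<exists>Q. eventually Q F \<and> (\<forall>n m. Q n \<longrightarrow> Q m \<longrightarrow> x n - x m \<in> U))"
    (is "(\<exists>B. ?P B) \<longleftrightarrow> (\<exists>Q. ?P' Q)") for U
  proof
    assume "\<exists>B. ?P B"
    then obtain B where "?P B" ..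
    then show "\<exists>Q. ?P' Q"
      by (intro exI[of _ "\<lambda>n. n \<in> B"]) simp
  next
    assume "\<exists>Q. ?P' Q"
    then obtain Q where "?P' Q" ..
    then show "\<exists>B. ?P B"
      by (intro exI[of _ "Collect Q"]) simp
  qed
  then show ?thesis
    using assms by (simp add: cauchy_over_def limitin_def eventually_prod_same)
qed

lemma cauchy_over_weak_l1_iff:
  fixes x :: "nat \<Rightarrow> nat \<Rightarrow> 'k::{real_normed_field,banach}"
  assumes "\<And>n. x n \<in> l1_set"
  shows "cauchy_over weak_l1 F x \<longleftrightarrow>
    (\<forall>a\<in>linf_set. ((\<lambda>(n, m). pairing a (x n) - pairing a (x m)) \<longlongrightarrow> 0) (F \<times>\<^sub>F F))"
proof -
  have "limitin weak_l1 (\<lambda>p. x (fst p) - x (snd p)) 0 (F \<times>\<^sub>F F) \<longleftrightarrow>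
    (\<forall>a\<in>linf_set. ((\<lambda>p. pairing a (x (fst p)) - pairing a (x (snd p))) \<longlongrightarrow> 0) (F \<times>\<^sub>F F))"
    by (subst limitin_weak_l1_iff)
       (auto simp: assms l1_set_diff zero_in_l1_set pairing_zero pairing_diff)
  then show ?thesis
    by (simp add: cauchy_over_iff_limitin topspace_weak_l1 zero_in_l1_set case_prod_unfold)
qed

text \<open>
  A neighbourhood \<open>U\<close> of \<open>0\<close> absorbs \<open>A\<close> when \<open>y / c\<close> enters \<open>U\<close> as \<open>c\<close> tends to infinity, uniformly
  for \<open>y\<close> in \<open>A\<close>; the product with the principal filter of \<open>A\<close> expresses the uniformity.
\<close>

lemma tvs_bounded_weak_l1:
  fixes A :: "(nat \<Rightarrow> 'k::{real_normed_field,banach}) set"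
  assumes A: "A \<subseteq> l1_set"
    and bounded: "\<And>a. a \<in> linf_set \<Longrightarrow> \<exists>M. \<forall>y\<in>A. norm (pairing a y) \<le> M"
  shows "tvs_bounded seq_scale weak_l1 A"
  unfolding tvs_bounded_def topspace_weak_l1
proof (intro conjI allI impI A, elim conjE)
  fix U :: "(nat \<Rightarrow> 'k) set" assume U: "openin weak_l1 U" "0 \<in> U"
  let ?G = "at_infinity \<times>\<^sub>F principal A"
  \<comment> \<open>Off \<open>A\<close> the value \<open>0\<close> is a placeholder that keeps the map inside the space.\<close>
  define f where "f = (\<lambda>(c, y). if y \<in> A then seq_scale (inverse c) y else (0 :: nat \<Rightarrow> 'k))"
  have in_A: "\<forall>\<^sub>F p in ?G. snd p \<in> A"
    using filterlim_snd[of "principal A" at_infinity] by (simp add: filterlim_principal)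
  have "limitin weak_l1 f 0 ?G"
  proof (subst limitin_weak_l1_iff, goal_cases)
    case (1 p)
    then show ?case
      using A by (auto simp: f_def zero_in_l1_set l1_set_scale split: prod.split)
  next
    case 2
    have "((\<lambda>p. pairing a (f p)) \<longlongrightarrow> 0) ?G" if a: "a \<in> linf_set" for a
    proof -
      obtain M where M: "\<forall>y\<in>A. norm (pairing a y) \<le> M"
        using bounded[OF a] by blast
      have "((\<lambda>c::'k. norm (inverse c) * M) \<longlongrightarrow> 0) at_infinity"
        by (intro tendsto_mult_left_zero tendsto_norm_zero tendsto_inverse_0)
      then have "((\<lambda>p::'k \<times> (nat \<Rightarrow> 'k). norm (inverse (fst p)) * M) \<longlongrightarrow> 0) ?G"
        by (rule filterlim_compose) (rule filterlim_fst)
      moreover have "\<forall>\<^sub>F p in ?G. norm (pairing a (f p)) \<le> norm (inverse (fst p)) * M"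
        using in_A
      proof eventually_elim
        case (elim p)
        then have "pairing a (f p) = inverse (fst p) * pairing a (snd p)"
          using A a by (auto simp: f_def case_prod_unfold pairing_scale)
        then show ?case
          using M elim by (simp only: norm_mult) (auto intro: mult_left_mono)
      qed
      ultimately show ?thesis
        by (rule Lim_null_comparison[rotated])
    qed
    then show ?case
      by (simp add: zero_in_l1_set pairing_zero)
  qed
  then have "\<forall>\<^sub>F p in ?G. f p \<in> U"
    using U by (simp add: limitin_def)
  then obtain P Q where P: "eventually P at_infinity" and Q: "\<forall>y\<in>A. Q y"
    and PQ: "\<And>c y. P c \<Longrightarrow> Q y \<Longrightarrow> f (c, y) \<in> U"
    unfolding eventually_prod_filter eventually_principal by blast
  obtain b where b: "\<And>c. b \<le> norm c \<Longrightarrow> P c"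
    using P unfolding eventually_at_infinity by blast
  show "\<exists>r>0. \<forall>c. norm c \<ge> r \<longrightarrow> A \<subseteq> seq_scale c ` U"
  proof (intro exI[of _ "max b 1"] conjI allI impI subsetI)
    fix c :: 'k and y assume c: "max b 1 \<le> norm c" and y: "y \<in> A"
    have "seq_scale (inverse c) y \<in> U"
      using PQ[of c y] b[of c] c y Q by (simp add: f_def)
    moreover have "c \<noteq> 0"
      using c by auto
    then have "y = seq_scale c (seq_scale (inverse c) y)"
      by (simp add: seq_scale_def fun_eq_iff)
    ultimately show "y \<in> seq_scale c ` U"
      by blast
  qed simp
qed


section \<open>Schur's theorem\<close>

text \<open>
  On any fixed initial segment the norms are eventually small, so a member of norm at least \<open>e\<close> far out
  in the sequence carries most of its norm beyond \<open>h\<close>, and in fact on a finite block beyond \<open>h\<close>. The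
  inequality says that the block outweighs everything else by at least \<open>e / 2\<close>.
\<close>

lemma norm_block_exists:
  fixes z :: "nat \<Rightarrow> nat \<Rightarrow> 'k::{real_normed_field,banach}"
  assumes l1: "\<And>n. z n \<in> l1_set"
    and coord: "\<And>j. (\<lambda>n. z n j) \<longlonglongrightarrow> 0"
    and e: "e > 0" "\<exists>\<^sub>F n in sequentially. (\<Sum>j. norm (z n j)) \<ge> e"
  shows "\<exists>m\<ge>i. \<exists>h'>h. (\<Sum>j. norm (z m j)) + e / 2 \<le> 2 * (\<Sum>j\<in>{h..<h'}. norm (z m j))"
proof -
  have "(\<lambda>n. \<Sum>j<h. norm (z n j)) \<longlonglongrightarrow> (\<Sum>j<h. 0)"
    by (intro tendsto_sum tendsto_norm_zero coord)
  then have "\<forall>\<^sub>F n in sequentially. (\<Sum>j<h. norm (z n j)) < e / 8"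
    by (rule order_tendstoD) (use e in simp)
  then have "\<exists>\<^sub>F n in sequentially.
      (\<Sum>j. norm (z n j)) \<ge> e \<and> ((\<Sum>j<h. norm (z n j)) < e / 8 \<and> n \<ge> i)"
    by (intro frequently_eventually_frequently[OF e(2)] eventually_conj eventually_ge_at_top)
  then obtain m where m: "(\<Sum>j. norm (z m j)) \<ge> e" "(\<Sum>j<h. norm (z m j)) < e / 8" "m \<ge> i"
    by (auto dest: frequently_ex)
  have "(\<lambda>n. \<Sum>j<n. norm (z m j)) \<longlonglongrightarrow> (\<Sum>j. norm (z m j))"
    using l1[of m] by (simp add: l1_set_def summable_LIMSEQ)
  then have "\<forall>\<^sub>F n in sequentially. (\<Sum>j<n. norm (z m j)) > (\<Sum>j. norm (z m j)) - e / 8"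
    by (rule order_tendstoD) (use e in simp)
  then have "\<forall>\<^sub>F n in sequentially. (\<Sum>j<n. norm (z m j)) > (\<Sum>j. norm (z m j)) - e / 8 \<and> n > h"
    by (intro eventually_conj eventually_gt_at_top)
  then obtain h' where h': "(\<Sum>j<h'. norm (z m j)) > (\<Sum>j. norm (z m j)) - e / 8" "h' > h"
    by (auto simp: eventually_sequentially)
  have "(\<Sum>j<h'. norm (z m j)) = (\<Sum>j<h. norm (z m j)) + (\<Sum>j\<in>{h..<h'}. norm (z m j))"
    using h'(2) sum.atLeastLessThan_concat[of 0 h h' "\<lambda>j. norm (z m j)"]
    by (simp add: lessThan_atLeast0)
  with m h' show ?thesis
    by (intro exI[of _ m] exI[of _ h'] conjI) auto
qed

lemma norm_pairing_ge_block:
  fixes a y :: "nat \<Rightarrow> 'k::{real_normed_field,banach}"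
  assumes y: "y \<in> l1_set" and a: "\<And>j. norm (a j) \<le> 1"
    and B: "finite B" "\<And>j. j \<in> B \<Longrightarrow> a j * y j = of_real (norm (y j))"
  shows "norm (pairing a y) \<ge> 2 * (\<Sum>j\<in>B. norm (y j)) - (\<Sum>j. norm (y j))"
proof -
  let ?S = "\<Sum>j\<in>B. norm (y j)"
  have sy: "summable (\<lambda>j. norm (y j))"
    using y by (simp add: l1_set_def)
  have say: "summable (\<lambda>j. a j * y j)"
    by (rule summable_pairing) (use y a in \<open>auto intro: linf_setI\<close>)
  have block: "(\<lambda>j. if j \<in> B then of_real (norm (y j)) else 0 :: 'k) sums of_real ?S"
    using sums_If_finite_set[OF B(1), of "\<lambda>j. of_real (norm (y j)) :: 'k"] by simp
  have block': "(\<lambda>j. if j \<in> B then norm (y j) else 0) sums ?S"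
    by (rule sums_If_finite_set[OF B(1)])
  have "norm (\<Sum>j. a j * y j - (if j \<in> B then of_real (norm (y j)) else 0))
      \<le> (\<Sum>j. norm (y j) - (if j \<in> B then norm (y j) else 0))"
  proof (rule norm_suminf_le)
    show "summable (\<lambda>j. norm (y j) - (if j \<in> B then norm (y j) else 0))"
      by (intro summable_diff sy sums_summable[OF block'])
    show "norm (a j * y j - (if j \<in> B then of_real (norm (y j)) else 0))
        \<le> norm (y j) - (if j \<in> B then norm (y j) else 0)" for j
      using B(2)[of j] mult_right_mono[OF a[of j] norm_ge_zero[of "y j"]] by (simp add: norm_mult)
  qed
  then have "norm (pairing a y - of_real ?S) \<le> (\<Sum>j. norm (y j)) - ?S"
    using suminf_diff[OF say sums_summable[OF block]] suminf_diff[OF sy sums_summable[OF block']]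
      sums_unique[OF block] sums_unique[OF block'] by (simp add: pairing_def)
  moreover have "norm (of_real ?S :: 'k) = ?S"
    by (simp only: norm_of_real) (simp add: sum_nonneg)
  moreover have "norm (of_real ?S :: 'k) - norm (pairing a y) \<le> norm (pairing a y - of_real ?S)"
    using norm_triangle_ineq2[of "of_real ?S" "pairing a y"] by (simp add: norm_minus_commute)
  ultimately show ?thesis
    by linarith
qed

text \<open>
  The humps can be chosen on consecutive disjoint blocks, so a single functional of norm at most \<open>1\<close>
  can match the signs of all of them. Its values on the humps are at least \<open>e / 2\<close> in modulus
  by \<open>norm_pairing_ge_block\<close>, which contradicts weak convergence to \<open>0\<close>.
\<close>

theorem l1_schur:
  fixes z :: "nat \<Rightarrow> nat \<Rightarrow> 'k::{real_normed_field,banach}"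
  assumes l1: "\<And>n. z n \<in> l1_set"
    and weak: "\<And>a. a \<in> linf_set \<Longrightarrow> (\<lambda>n. pairing a (z n)) \<longlonglongrightarrow> 0"
  shows "(\<lambda>n. \<Sum>j. norm (z n j)) \<longlonglongrightarrow> 0"
proof (rule ccontr)
  assume "\<not> ?thesis"
  then obtain e where e: "e > 0" "\<not> (\<forall>\<^sub>F n in sequentially. norm (\<Sum>j. norm (z n j)) < e)"
    by (auto simp: tendsto_iff)
  have nonneg: "(\<Sum>j. norm (z n j)) \<ge> 0" for n
    using l1[of n] by (intro suminf_nonneg) (auto simp: l1_set_def)
  have freq: "\<exists>\<^sub>F n in sequentially. (\<Sum>j. norm (z n j)) \<ge> e"
    using e(2) nonneg by (simp add: not_eventually not_less)
  have coord: "(\<lambda>n. z n j) \<longlonglongrightarrow> 0" for j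
    using weak[OF unit_vec_in_linf_set[of j]] by (simp add: pairing_unit_vec_left)
  \<comment> \<open>A state pairs the index of the current hump with the right end of its block, which is where
      the next block starts; the initial state only fixes where the first block starts.\<close>
  have "\<exists>s :: nat \<Rightarrow> nat \<times> nat. \<forall>i. True \<and> fst (s (Suc i)) \<ge> i \<and> snd (s i) < snd (s (Suc i)) \<and>
      (\<Sum>j. norm (z (fst (s (Suc i))) j)) + e / 2
        \<le> 2 * (\<Sum>j\<in>{snd (s i)..<snd (s (Suc i))}. norm (z (fst (s (Suc i))) j))"
    by (rule dependent_nat_choice)
       (use norm_block_exists[of z e, OF l1 coord e(1) freq] in auto)
  then obtain s :: "nat \<Rightarrow> nat \<times> nat" where s: "\<And>i. fst (s (Suc i)) \<ge> i"
      "\<And>i. snd (s i) < snd (s (Suc i))"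
      "\<And>i. (\<Sum>j. norm (z (fst (s (Suc i))) j)) + e / 2
        \<le> 2 * (\<Sum>j\<in>{snd (s i)..<snd (s (Suc i))}. norm (z (fst (s (Suc i))) j))"
    by blast
  define m where "m i = fst (s (Suc i))" for i
  define h where "h i = snd (s i)" for i
  have m: "m i \<ge> i" and hump: "(\<Sum>j. norm (z (m i) j)) + e / 2
      \<le> 2 * (\<Sum>j\<in>{h i..<h (Suc i)}. norm (z (m i) j))" for i
    using s by (auto simp: m_def h_def)
  have "mono h"
    using s(2) by (intro incseq_SucI) (auto simp: h_def less_imp_le)
  define block where "block j = (LEAST i. j < h (Suc i))" for j
  have block: "block j = i" if "j \<in> {h i..<h (Suc i)}" for i j
    unfolding block_def
  proof (rule Least_equality)
    fix k assume "j < h (Suc k)"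
    then have "h i < h (Suc k)"
      using that by simp
    then show "i \<le> k"
      using monoD[OF \<open>mono h\<close>, of "Suc k" i] by (meson not_less not_less_eq_eq)
  qed (use that in simp)
  \<comment> \<open>The conjugate sign of the hump to whose block \<open>j\<close> belongs; division by \<open>0\<close> gives \<open>0\<close>.\<close>
  define a where "a j = of_real (norm (z (m (block j)) j)) / z (m (block j)) j" for j
  have a_le: "norm (a j) \<le> 1" for j
    by (simp add: a_def norm_divide)
  have "a j * z (m i) j = of_real (norm (z (m i) j))" if "j \<in> {h i..<h (Suc i)}" for i j
    using block[OF that] by (simp add: a_def)
  then have ge: "norm (pairing a (z (m i)))
      \<ge> 2 * (\<Sum>j\<in>{h i..<h (Suc i)}. norm (z (m i) j)) - (\<Sum>j. norm (z (m i) j))" for i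
    by (intro norm_pairing_ge_block l1 a_le) auto
  have large: "norm (pairing a (z (m i))) \<ge> e / 2" for i
    using hump[of i] ge[of i] by linarith
  have "filterlim m sequentially sequentially"
    by (rule filterlim_at_top_mono[OF filterlim_ident]) (simp add: m)
  with weak[OF linf_setI, OF a_le] have "(\<lambda>i. pairing a (z (m i))) \<longlonglongrightarrow> 0"
    by (rule filterlim_compose)
  then have "\<forall>\<^sub>F i in sequentially. norm (pairing a (z (m i))) < e / 2"
    by (intro order_tendstoD(2)[OF tendsto_norm_zero]) (use e(1) in simp_all)
  then obtain i where "norm (pairing a (z (m i))) < e / 2"
    by (auto simp: eventually_sequentially)
  with large[of i] show False
    by simp
qed


section \<open>Sequential completeness\<close>

lemma weakly_cauchy_imp_norm_cauchy:
  fixes x :: "nat \<Rightarrow> nat \<Rightarrow> 'k::{real_normed_field,banach}"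
  assumes l1: "\<And>n. x n \<in> l1_set" and cauchy: "cauchy_over weak_l1 sequentially x" and e: "e > 0"
  shows "\<exists>N. \<forall>m\<ge>N. \<forall>n\<ge>N. (\<Sum>j. norm (x m j - x n j)) < e"
proof (rule ccontr)
  assume "\<not> ?thesis"
  then obtain p q where pq: "\<And>N. p N \<ge> N" "\<And>N. q N \<ge> N"
      "\<And>N. (\<Sum>j. norm (x (p N) j - x (q N) j)) \<ge> e"
    by (simp add: not_less) metis
  have "filterlim (\<lambda>N. (p N, q N)) (sequentially \<times>\<^sub>F sequentially) sequentially"
    using pq by (intro filterlim_Pair) (auto intro: filterlim_at_top_mono[OF filterlim_ident])
  then have "(\<lambda>N. pairing a (x (p N) - x (q N))) \<longlonglongrightarrow> 0" if "a \<in> linf_set" for a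
    using cauchy that l1
      filterlim_compose[of "\<lambda>(n, m). pairing a (x n) - pairing a (x m)" "nhds 0"
        "sequentially \<times>\<^sub>F sequentially" "\<lambda>N. (p N, q N)" sequentially]
    by (simp add: cauchy_over_weak_l1_iff pairing_diff)
  then have "(\<lambda>N. \<Sum>j. norm ((x (p N) - x (q N)) j)) \<longlonglongrightarrow> 0"
    by (intro l1_schur l1_set_diff l1)
  then have "\<forall>\<^sub>F N in sequentially. (\<Sum>j. norm ((x (p N) - x (q N)) j)) < e"
    by (rule order_tendstoD) (rule e)
  then obtain N where "(\<Sum>j. norm ((x (p N) - x (q N)) j)) < e"
    by (auto simp: eventually_sequentially)
  with pq(3)[of N] show False
    by simp
qed

lemma l1_norm_complete:
  fixes x :: "nat \<Rightarrow> nat \<Rightarrow> 'k::{real_normed_field,banach}"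
  assumes l1: "\<And>n. x n \<in> l1_set"
    and cauchy: "\<And>e. e > 0 \<Longrightarrow> \<exists>N. \<forall>m\<ge>N. \<forall>n\<ge>N. (\<Sum>j. norm (x m j - x n j)) < e"
  obtains y where "y \<in> l1_set" "(\<lambda>n. \<Sum>j. norm (x n j - y j)) \<longlonglongrightarrow> 0"
proof -
  have sm: "summable (\<lambda>j. norm (x m j - x n j))" for m n
    using l1_set_diff[OF l1 l1, of m n] by (simp add: l1_set_def)
  have part: "(\<Sum>j\<in>J. norm (x m j - x n j)) \<le> (\<Sum>j. norm (x m j - x n j))" if "finite J" for m n J
    using sum_le_suminf[OF sm that] by simp
  have "convergent (\<lambda>n. x n j)" for j
  proof (rule Cauchy_convergent, rule metric_CauchyI)
    fix e :: real assume "e > 0"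
    then obtain N where "\<forall>m\<ge>N. \<forall>n\<ge>N. (\<Sum>j. norm (x m j - x n j)) < e"
      using cauchy by blast
    then show "\<exists>M. \<forall>m\<ge>M. \<forall>n\<ge>M. dist (x m j) (x n j) < e"
      using le_less_trans[OF part[of "{j}"]] by (intro exI[of _ N]) (simp add: dist_norm)
  qed
  then obtain y where y: "\<And>j. (\<lambda>n. x n j) \<longlonglongrightarrow> y j"
    unfolding convergent_def by metis
  have close: "\<exists>N. \<forall>n\<ge>N. summable (\<lambda>j. norm (x n j - y j)) \<and> (\<Sum>j. norm (x n j - y j)) \<le> e"
    if e: "e > 0" for e
  proof -
    obtain N where N: "\<And>m n. m \<ge> N \<Longrightarrow> n \<ge> N \<Longrightarrow> (\<Sum>j. norm (x m j - x n j)) < e"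
      using cauchy[OF e] by blast
    \<comment> \<open>The bound passes to the limit on partial sums, where it involves finitely many coordinates.\<close>
    have bound: "(\<Sum>j<k. norm (x n j - y j)) \<le> e" if "n \<ge> N" for n k
    proof (rule tendsto_upperbound)
      show "(\<lambda>m. \<Sum>j<k. norm (x n j - x m j)) \<longlonglongrightarrow> (\<Sum>j<k. norm (x n j - y j))"
        by (intro tendsto_intros y)
      have "(\<Sum>j<k. norm (x n j - x m j)) \<le> e" if "m \<ge> N" for m
        using part[of "{..<k}" n m] N[OF \<open>n \<ge> N\<close> that] by simp
      then show "\<forall>\<^sub>F m in sequentially. (\<Sum>j<k. norm (x n j - x m j)) \<le> e"
        by (auto simp: eventually_sequentially)
    qed simp
    have "summable (\<lambda>j. norm (x n j - y j))" if "n \<ge> N" for n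
      using bound[OF that] by (intro summableI_nonneg_bounded) auto
    then show ?thesis
      using bound by (intro exI[of _ N]) (auto intro: suminf_le_const)
  qed
  obtain N where N: "\<And>n. n \<ge> N \<Longrightarrow> summable (\<lambda>j. norm (x n j - y j))"
    using close[of 1] by auto
  have "x N - y \<in> l1_set"
    using N[of N] by (simp add: l1_set_def)
  from l1_set_diff[OF l1[of N] this] have "y \<in> l1_set"
    by simp
  moreover have "(\<lambda>n. \<Sum>j. norm (x n j - y j)) \<longlonglongrightarrow> 0"
  proof (rule LIMSEQ_I)
    fix r :: real assume "r > 0"
    then obtain K where "\<forall>n\<ge>K. summable (\<lambda>j. norm (x n j - y j)) \<and> (\<Sum>j. norm (x n j - y j)) \<le> r / 2"
      using close[of "r / 2"] by auto
    with \<open>r > 0\<close> show "\<exists>no. \<forall>n\<ge>no. norm ((\<Sum>j. norm (x n j - y j)) - 0) < r"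
      by (intro exI[of _ K]) (force simp: suminf_nonneg)
  qed
  ultimately show ?thesis
    by (rule that)
qed

lemma l1_norm_limit_imp_weak_limit:
  fixes x :: "nat \<Rightarrow> nat \<Rightarrow> 'k::{real_normed_field,banach}"
  assumes l1: "\<And>n. x n \<in> l1_set" and y: "y \<in> l1_set"
    and lim: "((\<lambda>n. \<Sum>j. norm (x n j - y j)) \<longlongrightarrow> 0) F"
  shows "limitin weak_l1 x y F"
proof -
  have "((\<lambda>n. pairing a (x n)) \<longlongrightarrow> pairing a y) F" if a: "a \<in> linf_set" for a
  proof -
    obtain M where M: "\<And>n. norm (a n) \<le> M"
      using a unfolding linf_set_def bounded_iff by auto
    have "norm (pairing a (x n) - pairing a y) \<le> M * (\<Sum>j. norm (x n j - y j))" for n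
    proof -
      have s: "summable (\<lambda>j. norm (x n j - y j))"
        using l1_set_diff[OF l1 y, of n] by (simp add: l1_set_def)
      have "norm (pairing a (x n - y)) \<le> (\<Sum>j. M * norm (x n j - y j))"
        unfolding pairing_def
        using M s by (intro norm_suminf_le summable_mult) (auto simp: norm_mult intro: mult_right_mono)
      then show ?thesis
        using a l1 y s by (simp add: pairing_diff suminf_mult)
    qed
    then have "\<forall>\<^sub>F n in F. norm (pairing a (x n) - pairing a y) \<le> M * (\<Sum>j. norm (x n j - y j))"
      by simp
    then have "((\<lambda>n. pairing a (x n) - pairing a y) \<longlongrightarrow> 0) F"
      by (rule Lim_null_comparison) (rule tendsto_mult_right_zero[OF lim])
    then show ?thesis
      by (simp add: LIM_zero_iff)
  qed
  then show ?thesis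
    using y by (simp add: limitin_weak_l1_iff l1)
qed

theorem sequentially_complete_weak_l1:
  "sequentially_complete_tvs (weak_l1 :: (nat \<Rightarrow> 'k::{real_normed_field,banach}) topology)"
  unfolding sequentially_complete_tvs_def topspace_weak_l1
proof (intro allI impI, elim conjE)
  fix x :: "nat \<Rightarrow> nat \<Rightarrow> 'k" assume cauchy: "cauchy_over weak_l1 sequentially x" and "range x \<subseteq> l1_set"
  then have l1: "x n \<in> l1_set" for n
    by blast
  obtain y where "y \<in> l1_set" "(\<lambda>n. \<Sum>j. norm (x n j - y j)) \<longlonglongrightarrow> 0"
    using l1_norm_complete[of x, OF l1 weakly_cauchy_imp_norm_cauchy[OF l1 cauchy]] by blast
  then show "\<exists>y. limitin weak_l1 x y sequentially"
    using l1_norm_limit_imp_weak_limit[of x, OF l1] by blast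
qed


section \<open>Failure of bounded completeness over free ultrafilters\<close>

text \<open>
  Compactness provides a cluster point \<open>L\<close>; the sets of the ultrafilter together with the preimages of
  the neighbourhoods of \<open>L\<close> generate a proper filter, which by maximality is the ultrafilter itself.
\<close>

lemma ultrafilter_bounded_convergent:
  fixes a :: "'i \<Rightarrow> 'k::heine_borel"
  assumes F: "ultrafilter F" and a: "bounded (range a)"
  shows "\<exists>L. (a \<longlongrightarrow> L) F"
proof -
  have "compact (closure (range a))"
    using a by (simp add: compact_eq_bounded_closed bounded_closure)
  moreover have "filtermap a F \<noteq> bot"
    using F by (simp add: ultrafilter_def filtermap_bot_iff)
  moreover have "\<forall>\<^sub>F t in filtermap a F. t \<in> closure (range a)"
    by (simp add: eventually_filtermap closure_subset[THEN subsetD])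
  ultimately obtain L where L: "inf (nhds L) (filtermap a F) \<noteq> bot"
    unfolding compact_filter by blast
  let ?G = "inf F (filtercomap a (nhds L))"
  have "filtermap a ?G \<noteq> bot"
  proof
    assume "filtermap a ?G = bot"
    then have "\<forall>\<^sub>F n in ?G. False"
      by (simp add: filtermap_bot_iff)
    then obtain P Q where PQ: "eventually P F" "eventually Q (nhds L)" "\<And>n. P n \<Longrightarrow> Q (a n) \<Longrightarrow> False"
      unfolding eventually_inf eventually_filtercomap by metis
    have "\<forall>\<^sub>F t in inf (nhds L) (filtermap a F). False"
      unfolding eventually_inf eventually_filtermap
      by (rule exI[of _ Q], rule exI[of _ "\<lambda>t. \<not> Q t"])
         (use PQ in \<open>auto elim!: eventually_mono[of P]\<close>)
    with L show False
      by (simp add: eventually_False)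
  qed
  then have "?G \<noteq> bot"
    by (auto simp: filtermap_bot_iff)
  then have "?G = F"
    using F unfolding ultrafilter_def by (meson inf_le1)
  then have "F \<le> filtercomap a (nhds L)"
    by (metis inf_le2)
  then show ?thesis
    by (auto simp: filterlim_iff_le_filtercomap)
qed

theorem not_boundedly_complete_weak_l1:
  assumes "free_filter \<U>" "ultrafilter \<U>"
  shows "\<not> boundedly_complete_over seq_scale
    (weak_l1 :: (nat \<Rightarrow> 'k::{real_normed_field,banach,heine_borel}) topology) \<U>"
proof
  let ?e = "unit_vec :: nat \<Rightarrow> nat \<Rightarrow> 'k"
  assume complete: "boundedly_complete_over seq_scale (weak_l1 :: (nat \<Rightarrow> 'k) topology) \<U>"
  have "\<exists>M. \<forall>y\<in>range ?e. norm (pairing a y) \<le> M" if "a \<in> linf_set" for a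
    using that by (auto simp: linf_set_def bounded_iff pairing_unit_vec_right)
  then have "tvs_bounded seq_scale weak_l1 (range ?e)"
    by (intro tvs_bounded_weak_l1) (auto simp: unit_vec_in_l1_set)
  moreover have "cauchy_over weak_l1 \<U> ?e"
    unfolding cauchy_over_weak_l1_iff[of ?e, OF unit_vec_in_l1_set]
  proof
    fix a :: "nat \<Rightarrow> 'k" assume "a \<in> linf_set"
    then obtain L where L: "(a \<longlongrightarrow> L) \<U>"
      using ultrafilter_bounded_convergent[OF assms(2)] by (auto simp: linf_set_def)
    have "((\<lambda>p. a (fst p) - a (snd p)) \<longlongrightarrow> L - L) (\<U> \<times>\<^sub>F \<U>)"
      by (intro tendsto_diff filterlim_compose[OF L] filterlim_fst filterlim_snd)
    then show "((\<lambda>(n, m). pairing a (?e n) - pairing a (?e m)) \<longlongrightarrow> 0) (\<U> \<times>\<^sub>F \<U>)"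
      by (simp add: pairing_unit_vec_right case_prod_unfold)
  qed
  ultimately obtain y where "limitin weak_l1 ?e y \<U>"
    using complete unfolding boundedly_complete_over_def topspace_weak_l1
    by (metis image_subsetI unit_vec_in_l1_set)
  then have lim: "(a \<longlongrightarrow> pairing a y) \<U>" if "a \<in> linf_set" for a
    using that by (simp add: limitin_weak_l1_iff unit_vec_in_l1_set pairing_unit_vec_right)
  have \<U>: "\<U> \<noteq> bot"
    using assms(2) by (simp add: ultrafilter_def)
  have "y k = 0" for k
  proof (rule tendsto_unique[OF \<U>])
    show "(?e k \<longlongrightarrow> y k) \<U>"
      using lim[OF unit_vec_in_linf_set[of k]] by (simp add: pairing_unit_vec_left)
    have "\<forall>\<^sub>F n in cofinite. ?e k n = 0"
      by (auto simp: eventually_cofinite unit_vec_def)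
    then have "\<forall>\<^sub>F n in \<U>. ?e k n = 0"
      using assms(1) by (auto simp: free_filter_def le_filter_def)
    then show "(?e k \<longlongrightarrow> 0) \<U>"
      by (rule tendsto_eventually)
  qed
  then have "y = 0"
    by auto
  then have "((\<lambda>_. 1 :: 'k) \<longlongrightarrow> 0) \<U>"
    using lim[OF linf_setI[of "\<lambda>_. 1" 1]] by (simp add: pairing_zero)
  with tendsto_unique[OF \<U> this tendsto_const] show False
    by simp
qed

theorem theorem4p15:
  shows "(sequentially_complete_tvs (weak_l1 :: (nat \<Rightarrow> real) topology) \<and>
          (\<forall>\<U>. free_filter \<U> \<and> ultrafilter \<U> \<longrightarrow>
             \<not> boundedly_complete_over seq_scale (weak_l1 :: (nat \<Rightarrow> real) topology) \<U>)) \<and>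
         (sequentially_complete_tvs (weak_l1 :: (nat \<Rightarrow> complex) topology) \<and>
          (\<forall>\<U>. free_filter \<U> \<and> ultrafilter \<U> \<longrightarrow>
             \<not> boundedly_complete_over seq_scale (weak_l1 :: (nat \<Rightarrow> complex) topology) \<U>))"
  by (simp add: sequentially_complete_weak_l1 not_boundedly_complete_weak_l1)

end
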